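(* Let $(\mathcal{B},\mathcal{P})$ be an impacted building, $\mathcal{O}\in\mathcal{P}$ a vertex, and $\mathcal{H}$ a way out from $\mathcal{O}$ with vertices $\mathcal{O}_0=\mathcal{O},\mathcal{O}_1,\mathcal{O}_2,\dots$ where $h(\mathcal{O}_n)=n$. Then for all $n\ge0$, $$\zeta^{\mathcal{P}}_{\mathcal{O}_{n+1}}(X)=\zeta_{\mathcal{O}_{n+1}}(X)+X\,\zeta^{\mathcal{P}}_{\mathcal{O}_n}(X).$$
   Context: An impacted building is a pair $(\mathcal{B},\mathcal{P})$ where $\mathcal{B}$ is a building of type $\widetilde{A}_1$ (a tree whose apartments are bi-infinite lines) and $\mathcal{P}$ is a connected subcomplex. Set $\mathcal{P}_0=\mathcal{P}$, $\mathcal{P}_n=\{x: d(x,\mathcal{P}_{n-1})\le1\}$, $\mathcal{R}_0=\mathcal{P}$, $\mathcal{R}_n=\mathcal{P}_n\setminus\mathcal{P}_{n-1}$, $h(v)$ the unique $n$ with $v\in\mathcal{R}_n$. $\zeta_v(X)=\sum_{d\ge0}\#\{x\in\mathcal{R}_{h(v)}: x\text{ reachable from } v \text{ by a path of length } d\}X^d$ and $\zeta^{\mathcal{P}}_v(X)$ is the same with $\mathcal{P}_{h(v)}$ in place of $\mathcal{R}_{h(v)}$ (paths are walks, possibly backtracking, not required to stay in any layer). A way out from $\mathcal{O}\in\mathcal{P}$ is a half-apartment (geodesic ray) $\mathcal{H}$ with boundary vertex $\mathcal{O}$ such that for each $n\ge0$ there is a unique vertex $\mathcal{O}_n\in\mathcal{H}$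 with $h(\mathcal{O}_n)=n$. *)

theory Defs
  imports "HOL-Library.Extended_Nat" "HOL-Computational_Algebra.Formal_Power_Series"
begin

text \<open>Complexes are abstract simplicial complexes, given by their sets of (nonempty) simplices.\<close>

definition simplicial_complex :: "'a set set \<Rightarrow> bool" where
  "simplicial_complex K \<longleftrightarrow>
     (\<forall>s\<in>K. finite s \<and> s \<noteq> {}) \<and> (\<forall>s\<in>K. \<forall>t. t \<noteq> {} \<and> t \<subseteq> s \<longrightarrow> t \<in> K)"

definition verts :: "'a set set \<Rightarrow> 'a set" where
  "verts K = \<Union>K"

definition subcomplex :: "'a set set \<Rightarrow> 'a set set \<Rightarrow> bool" where
  "subcomplex L K \<longleftrightarrow> simplicial_complex L \<and> L \<subseteq> K"

definition adjacent :: "'a set set \<Rightarrow> 'a \<Rightarrow> 'a \<Rightarrow> bool" where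
  "adjacent K x y \<longleftrightarrow> x \<noteq> y \<and> {x, y} \<in> K"

text \<open>Walks are given by their lists of vertices and may backtrack.\<close>

definition walk_betw :: "'a set set \<Rightarrow> 'a \<Rightarrow> 'a list \<Rightarrow> 'a \<Rightarrow> bool" where
  "walk_betw K x xs y \<longleftrightarrow>
     xs \<noteq> [] \<and> hd xs = x \<and> last xs = y \<and> set xs \<subseteq> verts K \<and> successively (adjacent K) xs"

definition walk_length :: "'a list \<Rightarrow> nat" where
  "walk_length xs = length xs - 1"

definition reachable_in :: "'a set set \<Rightarrow> nat \<Rightarrow> 'a \<Rightarrow> 'a \<Rightarrow> bool" where
  "reachable_in K d x y \<longleftrightarrow> (\<exists>xs. walk_betw K x xs y \<and> walk_length xs = d)"

definition connected_complex :: "'a set set \<Rightarrow> bool" where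
  "connected_complex K \<longleftrightarrow>
     K \<noteq> {} \<and> (\<forall>x\<in>verts K. \<forall>y\<in>verts K. \<exists>xs. walk_betw K x xs y)"

definition is_cycle :: "'a set set \<Rightarrow> 'a list \<Rightarrow> bool" where
  "is_cycle K xs \<longleftrightarrow>
     3 \<le> length xs \<and> distinct xs \<and> successively (adjacent K) xs \<and> adjacent K (last xs) (hd xs)"

definition is_tree :: "'a set set \<Rightarrow> bool" where
  "is_tree K \<longleftrightarrow>
     simplicial_complex K \<and> (\<forall>s\<in>K. card s \<le> 2) \<and> connected_complex K \<and> (\<nexists>xs. is_cycle K xs)"

definition complex_iso :: "('a \<Rightarrow> 'a) \<Rightarrow> 'a set set \<Rightarrow> 'a set set \<Rightarrow> bool" where
  "complex_iso \<phi> K L \<longleftrightarrow> bij_betw \<phi> (verts K) (verts L) \<and> (\<lambda>s. \<phi> ` s) ` K = L"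

text \<open>A bi-infinite line is the Coxeter complex of type affine \<open>A\<^sub>1\<close>;
  \<open>f\<close> enumerates its vertices in order.\<close>

definition line_param :: "(int \<Rightarrow> 'a) \<Rightarrow> 'a set set \<Rightarrow> bool" where
  "line_param f A \<longleftrightarrow> inj f \<and> A = range (\<lambda>i. {f i}) \<union> range (\<lambda>i. {f i, f (i + 1)})"

text \<open>A building of type affine \<open>A\<^sub>1\<close> is a tree \<open>B\<close> together with a system \<open>\<A>\<close>
  of apartments satisfying the usual building axioms; no local finiteness or thickness is assumed,
  and \<open>\<A>\<close> need not be the complete system.\<close>

definition building_A1 :: "'a set set \<Rightarrow> 'a set set set \<Rightarrow> bool" where
  "building_A1 B \<A> \<longleftrightarrow>
     is_tree B \<and>
     (\<forall>A\<in>\<A>. subcomplex A B \<and> (\<exists>f. line_param f A)) \<and>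
     (\<forall>s\<in>B. \<forall>t\<in>B. \<exists>A\<in>\<A>. s \<in> A \<and> t \<in> A) \<and>
     (\<forall>A\<in>\<A>. \<forall>A'\<in>\<A>. \<forall>s\<in>A \<inter> A'. \<forall>t\<in>A \<inter> A'.
        \<exists>\<phi>. complex_iso \<phi> A A' \<and> (\<forall>x\<in>s \<union> t. \<phi> x = x))"

definition impacted_building :: "'a set set \<Rightarrow> 'a set set set \<Rightarrow> 'a set set \<Rightarrow> bool" where
  "impacted_building B \<A> P \<longleftrightarrow> building_A1 B \<A> \<and> subcomplex P B \<and> connected_complex P"

definition vdist :: "'a set set \<Rightarrow> 'a \<Rightarrow> 'a \<Rightarrow> enat" where
  "vdist K x y = (INF xs\<in>{xs. walk_betw K x xs y}. enat (walk_length xs))"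

definition vdist_set :: "'a set set \<Rightarrow> 'a \<Rightarrow> 'a set \<Rightarrow> enat" where
  "vdist_set K x S = (INF y\<in>S. vdist K x y)"

primrec layer_P :: "'a set set \<Rightarrow> 'a set set \<Rightarrow> nat \<Rightarrow> 'a set" where
  "layer_P B P 0 = verts P"
| "layer_P B P (Suc n) = {x \<in> verts B. vdist_set B x (layer_P B P n) \<le> 1}"

fun layer_R :: "'a set set \<Rightarrow> 'a set set \<Rightarrow> nat \<Rightarrow> 'a set" where
  "layer_R B P 0 = verts P"
| "layer_R B P (Suc n) = layer_P B P (Suc n) - layer_P B P n"

definition height :: "'a set set \<Rightarrow> 'a set set \<Rightarrow> 'a \<Rightarrow> nat" where
  "height B P v = (THE n. v \<in> layer_R B P n)"

text \<open>Since \<open>B\<close> may have vertices of infinite valency, the coefficients of the zeta functions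
  are extended natural numbers.\<close>

definition ecard :: "'a set \<Rightarrow> enat" where
  "ecard S = (if finite S then enat (card S) else \<infinity>)"

definition zeta :: "'a set set \<Rightarrow> 'a set set \<Rightarrow> 'a \<Rightarrow> enat fps" where
  "zeta B P v = Abs_fps (\<lambda>d. ecard {x \<in> layer_R B P (height B P v). reachable_in B d v x})"

definition zeta_P :: "'a set set \<Rightarrow> 'a set set \<Rightarrow> 'a \<Rightarrow> enat fps" where
  "zeta_P B P v = Abs_fps (\<lambda>d. ecard {x \<in> layer_P B P (height B P v). reachable_in B d v x})"

text \<open>Replacing \<open>f\<close> by \<open>\<lambda>i. f (- i)\<close> shows that both halves of an apartment
  at the vertex \<open>b\<close> are covered.\<close>

definition half_apartment :: "'a set set set \<Rightarrow> 'a \<Rightarrow> 'a set set \<Rightarrow> bool" where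
  "half_apartment \<A> b H \<longleftrightarrow>
     (\<exists>A\<in>\<A>. \<exists>f. line_param f A \<and> f 0 = b \<and>
        H = (\<lambda>i. {f i}) ` {0..} \<union> (\<lambda>i. {f i, f (i + 1)}) ` {0..})"

definition way_out :: "'a set set \<Rightarrow> 'a set set set \<Rightarrow> 'a set set \<Rightarrow> 'a \<Rightarrow> 'a set set \<Rightarrow> bool" where
  "way_out B \<A> P b H \<longleftrightarrow>
     b \<in> verts P \<and> half_apartment \<A> b H \<and> (\<forall>n. \<exists>!v. v \<in> verts H \<and> height B P v = n)"

end

theory Submission imports Defs begin

text \<open>Write \<open>u = \<O>\<^sub>n\<^sub>+\<^sub>1\<close> and \<open>w = \<O>\<^sub>n\<close>. Heights of neighbours differ by at most one, so the vertices
  of a way out are consecutive and \<open>u\<close>, \<open>w\<close> are adjacent. Deleting the edge \<open>{u, w}\<close> from the tree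
  separates \<open>u\<close> from the connected set \<open>\<P>\<^sub>n\<close>, hence every walk from \<open>u\<close> into \<open>\<P>\<^sub>n\<close> traverses this
  edge. The part of the walk before the first traversal is closed, so it has even length and can be
  replaced by going back and forth along the edge. Therefore \<open>x \<in> \<P>\<^sub>n\<close> is reachable from \<open>u\<close> in \<open>d\<close>
  steps iff \<open>d \<ge> 1\<close> and \<open>x\<close> is reachable from \<open>w\<close> in \<open>d - 1\<close> steps.\<close>

section \<open>Walks as powers of the adjacency relation\<close>

lemma relpowp_iff_successively:
  "(r ^^ d) x y \<longleftrightarrow> (\<exists>xs. length xs = Suc d \<and> hd xs = x \<and> last xs = y \<and> successively r xs)"
proof (induction d arbitrary: y)
  case 0
  have "(\<exists>xs. length xs = Suc 0 \<and> hd xs = x \<and> last xs = y \<and> successively r xs)" if "x = y"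
    using that by (intro exI[of _ "[x]"]) simp
  then show ?case by (auto simp: length_Suc_conv)
next
  case (Suc d)
  show ?case
  proof
    assume "(r ^^ Suc d) x y"
    then obtain z where "(r ^^ d) x z" "r z y" by auto
    with Suc obtain xs where "length xs = Suc d" "hd xs = x" "last xs = z" "successively r xs"
      by blast
    with \<open>r z y\<close> show "\<exists>xs. length xs = Suc (Suc d) \<and> hd xs = x \<and> last xs = y \<and> successively r xs"
      by (intro exI[of _ "xs @ [y]"]) (auto simp: successively_append_iff hd_append)
  next
    assume "\<exists>xs. length xs = Suc (Suc d) \<and> hd xs = x \<and> last xs = y \<and> successively r xs"
    then obtain xs where xs: "length xs = Suc (Suc d)" "hd xs = x" "last xs = y" "successively r xs"
      by blast
    then obtain ys where ys: "xs = ys @ [y]" "length ys = Suc d"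
      by (cases xs rule: rev_cases) auto
    then have "ys \<noteq> []" by auto
    with xs ys have "hd ys = x" "successively r ys" "r (last ys) y"
      by (auto simp: successively_append_iff hd_append)
    then have "(r ^^ d) x (last ys)" using Suc ys(2) by blast
    then show "(r ^^ Suc d) x y" using \<open>r (last ys) y\<close> by auto
  qed
qed

text \<open>When the next step returns to a vertex already on the path, the path is cut back to that
  vertex instead of being extended. Distinctness is what \<open>is_cycle\<close> later
  requires.\<close>

lemma rtranclp_imp_distinct_path:
  assumes "r\<^sup>*\<^sup>* x y"
  shows "\<exists>xs. xs \<noteq> [] \<and> distinct xs \<and> hd xs = x \<and> last xs = y \<and> successively r xs"
  using assms
proof (induction rule: rtranclp_induct)
  case base
  show ?case by (rule exI[of _ "[x]"]) simp
next
  case (step y z)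
  then obtain xs where xs: "xs \<noteq> []" "distinct xs" "hd xs = x" "last xs = y" "successively r xs"
    by blast
  show ?case
  proof (cases "z \<in> set xs")
    case True
    then obtain as bs where "xs = as @ z # bs" by (meson split_list)
    with xs show ?thesis
      by (intro exI[of _ "as @ [z]"]) (auto simp: successively_append_iff hd_append)
  next
    case False
    with xs step.hyps show ?thesis
      by (intro exI[of _ "xs @ [z]"]) (auto simp: successively_append_iff)
  qed
qed

lemma adjacent_sym: "adjacent K x y \<Longrightarrow> adjacent K y x"
  by (auto simp: adjacent_def insert_commute)

lemma adjacent_in_verts: "adjacent K x y \<Longrightarrow> x \<in> verts K" "adjacent K x y \<Longrightarrow> y \<in> verts K"
  by (auto simp: adjacent_def verts_def)

lemma adjacent_mono: "L \<subseteq> K \<Longrightarrow> adjacent L x y \<Longrightarrow> adjacent K x y"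
  by (auto simp: adjacent_def)

lemma successively_adjacent_in_verts:
  "successively (adjacent K) xs \<Longrightarrow> hd xs \<in> verts K \<Longrightarrow> set xs \<subseteq> verts K"
  by (induction xs rule: induct_list012) (auto dest: adjacent_in_verts)

text \<open>Only the start has to be required in \<open>verts K\<close>: adjacency places every
  later vertex there. From here on, walks are composed and split as powers of
  \<open>adjacent K\<close>.\<close>

lemma reachable_in_iff_relpowp:
  "reachable_in K d x y \<longleftrightarrow> x \<in> verts K \<and> (adjacent K ^^ d) x y"
proof
  assume "reachable_in K d x y"
  then obtain xs where xs: "walk_betw K x xs y" "walk_length xs = d"
    by (auto simp: reachable_in_def)
  then have "length xs = Suc d"
    by (cases xs) (auto simp: walk_betw_def walk_length_def)
  with xs show "x \<in> verts K \<and> (adjacent K ^^ d) x y"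
    by (auto simp: walk_betw_def relpowp_iff_successively dest!: subsetD[OF _ hd_in_set])
next
  assume "x \<in> verts K \<and> (adjacent K ^^ d) x y"
  then obtain xs where "x \<in> verts K" "length xs = Suc d" "hd xs = x" "last xs = y"
    "successively (adjacent K) xs"
    by (auto simp: relpowp_iff_successively)
  then show "reachable_in K d x y"
    unfolding reachable_in_def walk_betw_def walk_length_def
    by (intro exI[of _ xs]) (use successively_adjacent_in_verts in force)
qed

lemma walk_imp_rtranclp: "walk_betw K x xs y \<Longrightarrow> (adjacent K)\<^sup>*\<^sup>* x y"
  by (metis reachable_in_def reachable_in_iff_relpowp relpowp_imp_rtranclp)

section \<open>Parity of closed walks and separation by an edge of a tree\<close>

text \<open>A closed walk that is not a cycle splits at a repeated vertex into two shorter closed walks.\<close>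

lemma closed_walk_even:
  assumes "\<nexists>xs. is_cycle K xs"
    and "xs \<noteq> []" "successively (adjacent K) xs" "adjacent K (last xs) (hd xs)"
  shows "even (length xs)"
  using assms(2-)
proof (induction xs rule: length_induct)
  case (1 xs)
  show ?case
  proof (cases "distinct xs")
    case True
    with 1 assms(1) have "\<not> 3 \<le> length xs"
      unfolding is_cycle_def by blast
    moreover have "length xs \<noteq> 1"
      using 1 by (auto simp: length_Suc_conv adjacent_def)
    moreover have "length xs \<noteq> 0"
      using 1 by simp
    ultimately have "length xs = 2" by linarith
    then show ?thesis by simp
  next
    case False
    then obtain as bs cs a where xs: "xs = as @ [a] @ bs @ [a] @ cs"
      using not_distinct_decomp by blast
    then have xs: "xs = as @ (a # bs) @ (a # cs)" by simp
    from 1(3) have walks: "successively (adjacent K) as" "successively (adjacent K) (a # bs)"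
        "successively (adjacent K) (a # cs)" "adjacent K (last (a # bs)) a"
        "as \<noteq> [] \<Longrightarrow> adjacent K (last as) a"
      unfolding xs successively_append_iff by simp_all
    have "even (length (a # bs))"
      by (rule 1(1)[rule_format]) (use walks xs in simp_all)
    moreover have "successively (adjacent K) (as @ a # cs)"
      unfolding successively_append_iff using walks by auto
    \<comment> \<open>The closing edge is that of \<open>xs\<close>: if \<open>as\<close> is empty,
      then \<open>a\<close> is already the head of \<open>xs\<close>; if \<open>cs\<close> is empty,
      \<open>a\<close> is its last vertex.\<close>
    then have "even (length (as @ a # cs))"
      by (rule 1(1)[rule_format, rotated 2]) (use 1(4) xs in \<open>auto simp: hd_append split: if_splits\<close>)
    ultimately show ?thesis using xs by simp
  qed
qed

text \<open>Omitting the final return to \<open>x\<close>, a closed walk with \<open>d\<close> steps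
  lists exactly \<open>d\<close> vertices, so its parity is that of the list.\<close>

lemma relpowp_closed_even:
  assumes "\<nexists>xs. is_cycle K xs" "(adjacent K ^^ d) x x"
  shows "even d"
proof (cases d)
  case (Suc e)
  with assms obtain y where "(adjacent K ^^ e) x y" "adjacent K y x" by auto
  then obtain xs where "length xs = Suc e" "hd xs = x" "last xs = y" "successively (adjacent K) xs"
    by (auto simp: relpowp_iff_successively)
  then show ?thesis
    using closed_walk_even[OF assms(1), of xs] \<open>adjacent K y x\<close> Suc by force
qed simp

lemma even_imp_relpowp_closed:
  assumes "adjacent K u w" "even d"
  shows "(adjacent K ^^ d) w w"
proof -
  have "(adjacent K ^^ (2 * k)) w w" for k
    using assms(1) by (induction k) (auto intro: adjacent_sym relcomppI)
  with assms(2) show ?thesis by (metis evenE)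
qed

text \<open>Comparing unordered pairs deletes the edge in both directions.\<close>

definition adjacent_without :: "'a set set \<Rightarrow> 'a \<Rightarrow> 'a \<Rightarrow> 'a \<Rightarrow> 'a \<Rightarrow> bool" where
  "adjacent_without K u w x y \<longleftrightarrow> adjacent K x y \<and> {x, y} \<noteq> {u, w}"

text \<open>A repetition-free path from \<open>u\<close> to \<open>w\<close> avoiding the edge would
  become a cycle when closed by that edge.\<close>

lemma edge_separates:
  assumes "\<nexists>xs. is_cycle K xs" "adjacent K u w"
  shows "\<not> (adjacent_without K u w)\<^sup>*\<^sup>* u w"
proof
  assume "(adjacent_without K u w)\<^sup>*\<^sup>* u w"
  then obtain xs where xs: "xs \<noteq> []" "distinct xs" "hd xs = u" "last xs = w"
    "successively (adjacent_without K u w) xs"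
    using rtranclp_imp_distinct_path[of "adjacent_without K u w" u w] by blast
  have "u \<noteq> w" using assms(2) by (simp add: adjacent_def)
  \<comment> \<open>A single vertex would give \<open>u = w\<close>, and two vertices would use the
    deleted edge.\<close>
  have "3 \<le> length xs"
  proof (rule ccontr)
    assume "\<not> 3 \<le> length xs"
    moreover have "length xs \<noteq> 0" using xs(1) by simp
    ultimately consider "length xs = Suc 0" | "length xs = Suc (Suc 0)" by linarith
    then show False
      using xs \<open>u \<noteq> w\<close> by cases (auto simp: length_Suc_conv adjacent_without_def)
  qed
  moreover have "successively (adjacent K) xs"
    using xs(5) by (rule successively_mono) (simp add: adjacent_without_def)
  ultimately have "is_cycle K xs"
    using xs assms(2) by (auto simp: is_cycle_def adjacent_sym)
  then show False using assms(1) by blast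
qed

text \<open>Induction on the last step: the walk either ends on the side of \<open>u\<close>, or its
  endpoint can also be reached from \<open>w\<close> with one step fewer. The second alternative
  persists under any further step.\<close>

lemma relpowp_across_edge:
  assumes acyclic: "\<nexists>xs. is_cycle K xs" and edge: "adjacent K u w"
    and "(adjacent K ^^ d) u y"
  shows "(adjacent_without K u w)\<^sup>*\<^sup>* u y \<or> (\<exists>e. d = Suc e \<and> (adjacent K ^^ e) w y)"
  using assms(3)
proof (induction d arbitrary: y)
  case 0
  then show ?case by auto
next
  case (Suc d)
  then obtain z where z: "(adjacent K ^^ d) u z" "adjacent K z y" by auto
  from Suc.IH[OF z(1)] show ?case
  proof
    assume side: "(adjacent_without K u w)\<^sup>*\<^sup>* u z"
    show ?thesis
    proof (cases "{z, y} = {u, w}")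
      case True
      \<comment> \<open>The side of \<open>u\<close> does not contain \<open>w\<close>, so the edge
        can only be crossed from \<open>u\<close> to \<open>w\<close>, and the preceding
        \<open>d\<close> steps form a closed walk at \<open>u\<close>. An equally long closed walk
        at \<open>w\<close> replaces them, with \<open>e = d\<close>.\<close>
      have "z \<noteq> w" using side edge_separates[OF acyclic edge] by blast
      with True have "z = u" "y = w" by (auto simp: doubleton_eq_iff)
      with z(1) have "even d" using relpowp_closed_even[OF acyclic] by blast
      then have "(adjacent K ^^ d) w w" by (rule even_imp_relpowp_closed[OF edge])
      with \<open>y = w\<close> show ?thesis by blast
    next
      case False
      with z(2) have "adjacent_without K u w z y" by (simp add: adjacent_without_def)
      with side show ?thesis by (meson rtranclp.rtrancl_into_rtrancl)
    qed
  next
    assume "\<exists>e. d = Suc e \<and> (adjacent K ^^ e) w z"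
    with z(2) show ?thesis by auto
  qed
qed

lemma relpowp_into_separated_set:
  assumes "\<nexists>xs. is_cycle K xs" "adjacent K u w"
    and "(adjacent_without K u w)\<^sup>*\<^sup>* x w"
  shows "(adjacent K ^^ d) u x \<longleftrightarrow> (\<exists>e. d = Suc e \<and> (adjacent K ^^ e) w x)"
proof
  assume "(adjacent K ^^ d) u x"
  from relpowp_across_edge[OF assms(1,2) this]
  show "\<exists>e. d = Suc e \<and> (adjacent K ^^ e) w x"
    using edge_separates[OF assms(1,2)] assms(3) by (meson rtranclp_trans)
qed (use assms(2) in \<open>auto intro: relpowp_Suc_I2\<close>)

section \<open>Layers as iterated neighbourhoods, and heights\<close>

lemma vdist_set_le_1_iff:
  assumes "x \<in> verts K"
  shows "vdist_set K x S \<le> 1 \<longleftrightarrow> x \<in> S \<or> (\<exists>y\<in>S. adjacent K x y)"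
proof
  assume "vdist_set K x S \<le> 1"
  \<comment> \<open>A strict bound on an infimum yields an actual walk below the bound, which
    therefore has length 0 or 1.\<close>
  then have "vdist_set K x S < 2"
    by (rule order.strict_trans1) (simp add: one_enat_def numeral_eq_enat)
  then obtain y xs where y: "y \<in> S" "walk_betw K x xs y" "enat (walk_length xs) < 2"
    by (auto simp: vdist_set_def vdist_def INF_less_iff)
  then have "walk_length xs = 0 \<or> walk_length xs = 1"
    by (auto simp: numeral_eq_enat)
  moreover have "(adjacent K ^^ walk_length xs) x y"
    using y(2) reachable_in_iff_relpowp[of K "walk_length xs" x y]
    by (auto simp: reachable_in_def)
  ultimately have "x = y \<or> adjacent K x y" by auto
  with y(1) show "x \<in> S \<or> (\<exists>y\<in>S. adjacent K x y)" by blast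
next
  have le: "vdist_set K x S \<le> enat d" if "y \<in> S" "(adjacent K ^^ d) x y" for y d
  proof -
    from that(2) assms have "reachable_in K d x y"
      by (simp add: reachable_in_iff_relpowp)
    then obtain xs where xs: "walk_betw K x xs y" "walk_length xs = d"
      by (auto simp: reachable_in_def)
    then have "vdist K x y \<le> enat d"
      unfolding vdist_def by (intro INF_lower2[of xs]) auto
    with that(1) show ?thesis
      unfolding vdist_set_def by (meson INF_lower2)
  qed
  assume "x \<in> S \<or> (\<exists>y\<in>S. adjacent K x y)"
  then show "vdist_set K x S \<le> 1"
    using le[of x 0] le[of _ 1] by (auto simp: one_enat_def intro: order.trans)
qed

lemma layer_P_Suc_iff:
  "x \<in> layer_P B P (Suc n) \<longleftrightarrow>
     x \<in> verts B \<and> (x \<in> layer_P B P n \<or> (\<exists>y\<in>layer_P B P n. adjacent B x y))"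
  using vdist_set_le_1_iff[of x B] by auto

declare layer_P.simps(2) [simp del]

locale impacted_tree =
  fixes B P :: "'a set set"
  assumes tree: "is_tree B" and sub: "subcomplex P B" and conn: "connected_complex P"
begin

lemma no_cycle: "\<nexists>xs. is_cycle B xs"
  using tree by (simp add: is_tree_def)

lemma layer_P_subset_verts: "layer_P B P n \<subseteq> verts B"
proof (cases n)
  case 0
  then show ?thesis using sub by (auto simp: subcomplex_def verts_def)
qed (auto simp: layer_P_Suc_iff)

lemma layer_P_Suc_mono: "layer_P B P n \<subseteq> layer_P B P (Suc n)"
  using layer_P_subset_verts by (fastforce simp: layer_P_Suc_iff)

lemma layer_P_mono: "m \<le> n \<Longrightarrow> layer_P B P m \<subseteq> layer_P B P n"
  by (rule lift_Suc_mono_le[of "layer_P B P"]) (use layer_P_Suc_mono in auto)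

lemma adjacent_layer_P_Suc:
  "x \<in> layer_P B P n \<Longrightarrow> adjacent B x y \<Longrightarrow> y \<in> layer_P B P (Suc n)"
  by (meson adjacent_in_verts(2) adjacent_sym layer_P_Suc_iff)

text \<open>Along a walk from a vertex of \<open>P\<close>, each edge raises the layer index by at
  most one; \<open>P\<close> has a vertex because connectedness includes nonemptiness.\<close>

lemma ex_layer_P:
  assumes "x \<in> verts B"
  shows "\<exists>n. x \<in> layer_P B P n"
proof -
  from conn have "P \<noteq> {}" by (simp add: connected_complex_def)
  then obtain s where "s \<in> P" by blast
  moreover from this have "s \<noteq> {}"
    using sub by (simp add: subcomplex_def simplicial_complex_def)
  ultimately obtain p where p: "p \<in> verts P" by (auto simp: verts_def)
  then have "p \<in> verts B" using sub by (auto simp: subcomplex_def verts_def)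
  then have "(adjacent B)\<^sup>*\<^sup>* p x"
    using tree assms by (auto simp: is_tree_def connected_complex_def dest: walk_imp_rtranclp)
  then show ?thesis
  proof (induction rule: rtranclp_induct)
    case base
    show ?case using p by (intro exI[of _ 0]) simp
  next
    case (step y z)
    then show ?case using adjacent_layer_P_Suc by blast
  qed
qed

text \<open>The sets \<open>layer_P B P n\<close> increase with \<open>n\<close>, so a vertex is new
  at exactly one index. This makes the description in \<open>height\<close> unique.\<close>

lemma layer_R_iff_Least:
  assumes "x \<in> verts B"
  shows "x \<in> layer_R B P n \<longleftrightarrow> n = (LEAST m. x \<in> layer_P B P m)"
proof (cases n)
  case 0
  then show ?thesis
    using LeastI_ex[OF ex_layer_P[OF assms]] by (auto intro!: Least_equality[symmetric])
next
  case (Suc k)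
  show ?thesis
  proof
    assume "x \<in> layer_R B P n"
    with Suc have "x \<in> layer_P B P n" "x \<notin> layer_P B P k" by auto
    then show "n = (LEAST m. x \<in> layer_P B P m)"
      using Suc layer_P_mono by (intro Least_equality[symmetric]) (auto, meson not_less_eq_eq subsetD)
  next
    assume "n = (LEAST m. x \<in> layer_P B P m)"
    with Suc show "x \<in> layer_R B P n"
      using LeastI_ex[OF ex_layer_P[OF assms]] not_less_Least[of k "\<lambda>m. x \<in> layer_P B P m"] by auto
  qed
qed

lemma height_eq_Least:
  assumes "x \<in> verts B"
  shows "height B P x = (LEAST n. x \<in> layer_P B P n)"
  unfolding height_def layer_R_iff_Least[OF assms] by simp

lemma layer_P_iff_height_le:
  assumes "x \<in> verts B"
  shows "x \<in> layer_P B P n \<longleftrightarrow> height B P x \<le> n"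
  using LeastI_ex[OF ex_layer_P[OF assms]] layer_P_mono
  by (auto simp: height_eq_Least[OF assms] intro: Least_le)

lemma height_adjacent_le:
  assumes "adjacent B x y"
  shows "height B P y \<le> Suc (height B P x)"
  using adjacent_layer_P_Suc[OF _ assms] adjacent_in_verts[OF assms]
  by (meson layer_P_iff_height_le order_refl)

text \<open>Each vertex of a new layer is joined by one edge to the previous set, which is connected
  by induction. The path must stay inside the layer set so that it avoids edges leaving it.\<close>

lemma layer_P_connected:
  assumes "x \<in> layer_P B P n" "y \<in> layer_P B P n"
  shows "(\<lambda>a b. adjacent B a b \<and> a \<in> layer_P B P n \<and> b \<in> layer_P B P n)\<^sup>*\<^sup>* x y"
  using assms
proof (induction n arbitrary: x y)
  case 0
  then have "(adjacent P)\<^sup>*\<^sup>* x y"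
    using conn by (auto simp: connected_complex_def dest: walk_imp_rtranclp)
  then show ?case
    by (rule rtranclp_mono[THEN predicate2D, rotated])
      (use sub in \<open>auto simp: subcomplex_def intro: adjacent_mono adjacent_in_verts\<close>)
next
  case (Suc n)
  let ?r = "\<lambda>n a b. adjacent B a b \<and> a \<in> layer_P B P n \<and> b \<in> layer_P B P n"
  have sym: "symp (?r m)" for m by (auto simp: symp_def adjacent_sym)
  have down: "\<exists>z\<in>layer_P B P n. (?r (Suc n))\<^sup>*\<^sup>* x z" if "x \<in> layer_P B P (Suc n)" for x
  proof (cases "x \<in> layer_P B P n")
    case False
    with that obtain z where "z \<in> layer_P B P n" "adjacent B x z"
      by (auto simp: layer_P_Suc_iff)
    with that show ?thesis using layer_P_Suc_mono[of n] by blast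
  qed blast
  obtain x' y' where x': "x' \<in> layer_P B P n" "(?r (Suc n))\<^sup>*\<^sup>* x x'"
    and y': "y' \<in> layer_P B P n" "(?r (Suc n))\<^sup>*\<^sup>* y y'"
    using Suc.prems down by blast
  have "(?r n)\<^sup>*\<^sup>* x' y'" using Suc.IH x' y' by blast
  then have "(?r (Suc n))\<^sup>*\<^sup>* x' y'"
    by (rule rtranclp_mono[THEN predicate2D, rotated]) (use layer_P_Suc_mono[of n] in blast)
  moreover have "(?r (Suc n))\<^sup>*\<^sup>* y' y"
    using y'(2) symp_rtranclp[OF sym] by (meson sympD)
  ultimately show ?case using x'(2) by (meson rtranclp_trans)
qed

text \<open>A path from \<open>x\<close> to \<open>w\<close> inside \<open>layer_P B P n\<close>
  never meets \<open>u\<close>, hence avoids the edge between \<open>u\<close> and \<open>w\<close>;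
  so \<open>x\<close> lies on the side of \<open>w\<close>.\<close>

lemma reachable_in_layer_P:
  assumes "adjacent B u w" "u \<notin> layer_P B P n" "w \<in> layer_P B P n" "x \<in> layer_P B P n"
  shows "reachable_in B d u x \<longleftrightarrow> (\<exists>e. d = Suc e \<and> reachable_in B e w x)"
proof -
  have "(adjacent_without B u w)\<^sup>*\<^sup>* x w"
    using layer_P_connected[OF assms(4,3)]
    by (rule rtranclp_mono[THEN predicate2D, rotated])
      (use assms(2) in \<open>auto simp: adjacent_without_def doubleton_eq_iff\<close>)
  from relpowp_into_separated_set[OF no_cycle assms(1) this, of d]
  show ?thesis using adjacent_in_verts[OF assms(1)] by (simp add: reachable_in_iff_relpowp)
qed

text \<open>Heights grow by at most one per step, so \<open>f i\<close> has height at most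
  \<open>i\<close>; all smaller heights are already taken by earlier vertices, and injectivity
  excludes them.\<close>

lemma height_ray:
  fixes f :: "nat \<Rightarrow> 'a"
  assumes "\<And>i. adjacent B (f i) (f (Suc i))" "height B P (f 0) = 0" "inj (\<lambda>i. height B P (f i))"
  shows "height B P (f i) = i"
proof (induction i rule: less_induct)
  case (less i)
  show ?case
  proof (cases i)
    case 0
    with assms(2) show ?thesis by simp
  next
    case (Suc j)
    have "height B P (f i) \<le> Suc (height B P (f j))"
      using height_adjacent_le[OF assms(1)[of j]] Suc by simp
    then have "height B P (f i) \<le> i" using less[of j] Suc by simp
    moreover have "\<not> height B P (f i) < i"
    proof
      assume lt: "height B P (f i) < i"
      then have "height B P (f (height B P (f i))) = height B P (f i)" by (rule less)
      with assms(3) have "height B P (f i) = i" by (auto dest: injD)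
      with lt show False by simp
    qed
    ultimately show ?thesis by simp
  qed
qed

end

section \<open>Comparison of coefficients\<close>

lemma ecard_Un_disjoint: "S \<inter> T = {} \<Longrightarrow> ecard (S \<union> T) = ecard S + ecard T"
  by (auto simp: ecard_def card_Un_disjoint)

theorem theorem2p12:
  fixes B P H :: "'a set set" and \<A> :: "'a set set set" and b :: 'a and Os :: "nat \<Rightarrow> 'a"
  assumes "impacted_building B \<A> P"
    and "b \<in> verts P"
    and "way_out B \<A> P b H"
    and "Os 0 = b"
    and "\<And>n. Os n \<in> verts H \<and> height B P (Os n) = n"
  shows "\<forall>n. zeta_P B P (Os (n + 1)) = zeta B P (Os (n + 1)) + fps_X * zeta_P B P (Os n)"
proof
  fix n
  interpret impacted_tree B P
    using assms(1) by unfold_locales (auto simp: impacted_building_def building_A1_def)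
  obtain A f where A: "A \<in> \<A>" "line_param f A" "f 0 = b"
    and H: "H = (\<lambda>i. {f i}) ` {0..} \<union> (\<lambda>i. {f i, f (i + 1)}) ` {0..}"
    using assms(3) by (auto simp: way_out_def half_apartment_def)
  have "A \<subseteq> B"
    using A(1) assms(1) by (auto simp: impacted_building_def building_A1_def subcomplex_def)
  \<comment> \<open>\<open>g\<close> lists the vertices of \<open>H\<close> in order from
    \<open>b\<close>, as \<open>H\<close> uses only the nonnegative indices of the
    apartment.\<close>
  define g where "g i = f (int i)" for i
  have "inj f" using A(2) by (simp add: line_param_def)
  then have "inj g" using inj_compose[OF _ inj_of_nat] by (simp add: g_def[abs_def] o_def)
  have g_adjacent: "adjacent B (g i) (g (Suc i))" for i
  proof -
    have "{f (int i), f (int i + 1)} \<in> A" using A(2) by (auto simp: line_param_def)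
    then have "{g i, g (Suc i)} \<in> B" using \<open>A \<subseteq> B\<close> by (auto simp: g_def add.commute)
    moreover have "g i \<noteq> g (Suc i)" using \<open>inj g\<close> by (auto dest: injD)
    ultimately show ?thesis by (simp add: adjacent_def)
  qed
  have g_H: "g i \<in> verts H" for i
    by (auto simp: H verts_def g_def)
  have height_inj: "v = v'"
    if "v \<in> verts H" "v' \<in> verts H" "height B P v = height B P v'" for v v'
    using assms(3) that unfolding way_out_def by metis
  have "inj (\<lambda>i. height B P (g i))"
    using height_inj[OF g_H g_H] \<open>inj g\<close> by (auto simp: inj_def)
  moreover have "height B P (g 0) = 0"
    using assms(4) assms(5)[of 0] A(3) by (simp add: g_def)
  ultimately have "height B P (g i) = i" for i
    using height_ray[of g] g_adjacent by blast
  \<comment> \<open>Both vertices lie in \<open>H\<close> at height \<open>i\<close>, where the way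
    out has only one vertex. Hence consecutive \<open>Os\<close> are adjacent.\<close>
  then have Os: "Os i = g i" for i
    using height_inj[OF _ g_H] assms(5) by metis
  have edge: "adjacent B (Os (Suc n)) (Os n)"
    using g_adjacent Os by (simp add: adjacent_sym)
  have ht: "height B P (Os i) = i" for i
    using assms(5) by blast
  have "Os i \<in> verts B" for i
    using Os g_adjacent adjacent_in_verts by metis
  then have "Os (Suc n) \<notin> layer_P B P n" "Os n \<in> layer_P B P n"
    by (auto simp: layer_P_iff_height_le ht)
  then have reach: "reachable_in B d (Os (Suc n)) x \<longleftrightarrow> (\<exists>e. d = Suc e \<and> reachable_in B e (Os n) x)"
    if "x \<in> layer_P B P n" for d x
    using reachable_in_layer_P[OF edge _ _ that] by blast
  show "zeta_P B P (Os (n + 1)) = zeta B P (Os (n + 1)) + fps_X * zeta_P B P (Os n)"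
  proof (rule fps_ext)
    fix d
    let ?reach = "reachable_in B d (Os (Suc n))"
    have "{x \<in> layer_P B P (Suc n). ?reach x} =
        {x \<in> layer_R B P (Suc n). ?reach x} \<union> {x \<in> layer_P B P n. ?reach x}"
      using layer_P_Suc_mono[of n] by auto
    then have "ecard {x \<in> layer_P B P (Suc n). ?reach x} =
        ecard {x \<in> layer_R B P (Suc n). ?reach x} + ecard {x \<in> layer_P B P n. ?reach x}"
      by (simp only:) (rule ecard_Un_disjoint, auto)
    moreover have "ecard {x \<in> layer_P B P n. ?reach x} = fps_nth (fps_X * zeta_P B P (Os n)) d"
    proof (cases d)
      \<comment> \<open>No walk of length 0 leads from \<open>Os (Suc n)\<close> into
        \<open>layer_P B P n\<close>, matching the zero constant coefficient after multiplication by
        \<open>fps_X\<close>.\<close>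
      case 0
      then have empty: "{x \<in> layer_P B P n. ?reach x} = {}" using reach by auto
      show ?thesis unfolding empty using 0 by (simp add: ecard_def flip: zero_enat_def)
    next
      case (Suc e)
      then have "{x \<in> layer_P B P n. ?reach x} = {x \<in> layer_P B P n. reachable_in B e (Os n) x}"
        using reach by auto
      with Suc show ?thesis by (simp add: zeta_P_def ht)
    qed
    ultimately show "fps_nth (zeta_P B P (Os (n + 1))) d =
        fps_nth (zeta B P (Os (n + 1)) + fps_X * zeta_P B P (Os n)) d"
      by (simp add: zeta_P_def zeta_def ht)
  qed
qed

end
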